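(* Let $n$ be an integer greater than $1$. The map $\Phi\colon\mathcal{C}_n/\mathrm{SL}_2(\mathbb{Z})\longrightarrow \mathbf{FR}_n$, which sends the $\mathrm{SL}_2(\mathbb{Z})$-orbit of a closed path of length $n$ in the Farey graph (extended to an $n$-periodic bi-infinite path with suitably normalised vertices $a_i/b_i$) to $\pm\mathbf{M}$, where $m_{i,j}=a_jb_i-b_ja_i$, is a one-to-one correspondence (a bijection).
   Context: An $\mathrm{SL}_2$-tiling is a function $\mathbf{M}\colon\mathbb{Z}\times\mathbb{Z}\to\mathbb{Z}$, with $m_{i,j}=\mathbf{M}(i,j)$, such that $m_{i,j}m_{i+1,j+1}-m_{i,j+1}m_{i+1,j}=1$ for all $i,j\in\mathbb{Z}$. It is tame if every $3\times 3$ submatrix of consecutive rows and columns has determinant $0$. A tame frieze of order $n$ is a tame $\mathrm{SL}_2$-tiling $\mathbf{M}$ such that $m_{i,i}=m_{i+n,i}=0$ for all $i\in\mathbb{Z}$. $\mathbf{FR}_n$ is the set of tame friezes of order $n$ with $\mathbf{M}$ and $-\mathbf{M}$ identified; elements are written $\pm\mathbf{M}$. A reduced rational is an expression $a/b$ with $a,b$ coprime integers, where $1/0$ and $(-1)/0$ are allowed and both represent $\infty$. The Farey graph $\mathcal{F}$ has vertex set $\mathbb{Q}_\infty=\mathbb{Q}\cup\{\infty\}$, with reduced rationals $a/b$ and $c/d$ adjacent if and only if $ad-bc=\pm1$. A closed path of length $n$ in $\mathcal{F}$ is a sequence $\langle v_0,v_1,\dots,v_n\rangle$ of vertices with $v_i$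 adjacent to $v_{i+1}$ for $0\leq i<n$ and $v_0=v_n$. $\mathcal{C}_n$ is the set of closed paths of length $n$; it is identified with the set of bi-infinite paths $\langle\dots,v_{-1},v_0,v_1,v_2,\dots\rangle$ satisfying $v_i=v_j$ whenever $i\equiv j\pmod n$. $\mathrm{SL}_2(\mathbb{Z})$ acts on $\mathbb{Q}_\infty$ by Möbius transformations $z\mapsto\frac{az+b}{cz+d}$, preserving adjacency, hence acts vertexwise on $\mathcal{C}_n$. Given a bi-infinite path $\gamma$, write its vertices as reduced rationals $v_i=a_i/b_i$ with $a_ib_{i+1}-a_{i+1}b_i=1$ for all $i\in\mathbb{Z}$ (possible in exactly two ways, differing by a global sign), and put $m_{i,j}=a_jb_i-b_ja_i$. The resulting $\pm\mathbf{M}$ (a tame $\mathrm{SL}_2$-tiling up to sign) depends only on the $\mathrm{SL}_2(\mathbb{Z})$-orbit of $\gamma$; this is $\Phi$ of that orbit. *)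

theory Defs
  imports "HOL-Analysis.Determinants" "HOL-Algebra.Group_Action"
begin

section \<open>Tame friezes\<close>

definition SL2_tiling :: "(int \<Rightarrow> int \<Rightarrow> int) \<Rightarrow> bool" where
  "SL2_tiling m \<longleftrightarrow>
     (\<forall>i j. m i j * m (i + 1) (j + 1) - m i (j + 1) * m (i + 1) j = 1)"

definition tame :: "(int \<Rightarrow> int \<Rightarrow> int) \<Rightarrow> bool" where
  "tame m \<longleftrightarrow>
     (\<forall>i j. det (vector
        [vector [m i j,       m i (j + 1),       m i (j + 2)],
         vector [m (i + 1) j, m (i + 1) (j + 1), m (i + 1) (j + 2)],
         vector [m (i + 2) j, m (i + 2) (j + 1), m (i + 2) (j + 2)]] :: int^3^3) = 0)"

definition tame_frieze :: "nat \<Rightarrow> (int \<Rightarrow> int \<Rightarrow> int) \<Rightarrow> bool" where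
  "tame_frieze n m \<longleftrightarrow>
     SL2_tiling m \<and> tame m \<and> (\<forall>i. m i i = 0 \<and> m (i + int n) i = 0)"

text \<open>The class of a tiling when tilings are identified with their negatives.\<close>

definition plus_minus :: "(int \<Rightarrow> int \<Rightarrow> int) \<Rightarrow> (int \<Rightarrow> int \<Rightarrow> int) set" where
  "plus_minus m = {m, \<lambda>i j. - m i j}"

definition FR :: "nat \<Rightarrow> (int \<Rightarrow> int \<Rightarrow> int) set set" where
  "FR n = plus_minus ` {m. tame_frieze n m}"

section \<open>The Farey graph and closed paths\<close>

datatype qinf = Fin rat | Infty

text \<open>The element of \<open>\<rat> \<union> {\<infinity>}\<close> represented by the expression \<open>a/b\<close>; it is only used for
  integers \<open>a\<close> and \<open>b\<close> that are not both zero.\<close>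

definition frac_of :: "int \<Rightarrow> int \<Rightarrow> qinf" where
  "frac_of a b = (if b = 0 then Infty else Fin (of_int a / of_int b))"

text \<open>A vertex has exactly two reduced representatives, \<open>a/b\<close> and \<open>(-a)/(-b)\<close>, so the
  condition below does not depend on the choice of representatives.\<close>

definition farey_adjacent :: "qinf \<Rightarrow> qinf \<Rightarrow> bool" where
  "farey_adjacent x y \<longleftrightarrow>
     (\<exists>a b c d. coprime a b \<and> coprime c d \<and> x = frac_of a b \<and> y = frac_of c d \<and>
        (a * d - b * c = 1 \<or> a * d - b * c = -1))"

text \<open>A closed path \<open>\<langle>v\<^sub>0, \<dots>, v\<^sub>n\<rangle>\<close> of length \<open>n\<close> is a list of \<open>n + 1\<close> vertices.\<close>

definition closed_paths :: "nat \<Rightarrow> qinf list set" where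
  "closed_paths n =
     {vs. length vs = n + 1 \<and> (\<forall>i<n. farey_adjacent (vs ! i) (vs ! (i + 1))) \<and> vs ! 0 = vs ! n}"

definition periodic_extension :: "nat \<Rightarrow> qinf list \<Rightarrow> int \<Rightarrow> qinf" where
  "periodic_extension n vs i = vs ! nat (i mod int n)"

section \<open>The action of \<open>SL\<^sub>2(\<int>)\<close>\<close>

definition SL2Z :: "(int^2^2) monoid" where
  "SL2Z = \<lparr>carrier = {A. det A = 1}, monoid.mult = (**), one = mat 1\<rparr>"

fun mobius :: "int^2^2 \<Rightarrow> qinf \<Rightarrow> qinf" where
  "mobius A Infty = frac_of (A $ 1 $ 1) (A $ 2 $ 1)"
| "mobius A (Fin z) =
     (let p = of_int (A $ 1 $ 1) * z + of_int (A $ 1 $ 2);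
          q = of_int (A $ 2 $ 1) * z + of_int (A $ 2 $ 2)
      in if q = 0 then Infty else Fin (p / q))"

definition path_orbits :: "nat \<Rightarrow> qinf list set set" where
  "path_orbits n = orbits SL2Z (closed_paths n) (\<lambda>A. map (mobius A))"

section \<open>The map from orbits of paths to friezes\<close>

definition normalised :: "(int \<Rightarrow> qinf) \<Rightarrow> (int \<Rightarrow> int) \<Rightarrow> (int \<Rightarrow> int) \<Rightarrow> bool" where
  "normalised v a b \<longleftrightarrow>
     (\<forall>i. coprime (a i) (b i) \<and> v i = frac_of (a i) (b i) \<and>
          a i * b (i + 1) - a (i + 1) * b i = 1)"

definition tiling_of :: "(int \<Rightarrow> int) \<Rightarrow> (int \<Rightarrow> int) \<Rightarrow> int \<Rightarrow> int \<Rightarrow> int" where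
  "tiling_of a b i j = a j * b i - b j * a i"

text \<open>The common value of \<open>\<plusminus>M\<close> over all paths in the orbit and all normalised ways of
  writing their vertices. A normalised expression is unique up to a global sign, and acting by
  \<open>SL\<^sub>2(\<int>)\<close> leaves the determinants \<open>a\<^sub>j b\<^sub>i - b\<^sub>j a\<^sub>i\<close> unchanged, so this is well defined on
  the orbits of closed paths.\<close>

definition Phi :: "nat \<Rightarrow> qinf list set \<Rightarrow> (int \<Rightarrow> int \<Rightarrow> int) set" where
  "Phi n X = (THE P. \<forall>vs\<in>X. \<forall>a b. normalised (periodic_extension n vs) a b \<longrightarrow>
                P = plus_minus (tiling_of a b))"

end

theory Submission
  imports Defs
begin

text \<open>Normalised representatives of a path are unique up to a global sign, so a path has a
  well-defined tiling \<open>m\<close>, with \<open>m\<^sub>i\<^sub>,\<^sub>i\<^sub>+\<^sub>1 = -1\<close>. Two paths lie in the same orbit exactly when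
  their tilings agree, because a path is determined by \<open>m\<close> and its first two representatives.
  Conversely, tameness forces every row of a tame frieze to be a combination of rows \<open>0\<close> and \<open>1\<close>,
  and, after a change of sign, \<open>a\<^sub>j = m\<^sub>0\<^sub>,\<^sub>j\<close> and \<open>b\<^sub>j = m\<^sub>1\<^sub>,\<^sub>j\<close> are normalised representatives
  of a closed path with tiling \<open>m\<close>.\<close>

section \<open>Reduced rationals\<close>

lemma frac_of_eq_iff:
  assumes "a \<noteq> 0 \<or> b \<noteq> 0" "c \<noteq> 0 \<or> d \<noteq> 0"
  shows "frac_of a b = frac_of c d \<longleftrightarrow> a * d = b * c"
proof (cases "b = 0 \<or> d = 0")
  case True
  then show ?thesis using assms by (auto simp: frac_of_def)
next
  case False
  then have "frac_of a b = frac_of c d \<longleftrightarrow> (of_int (a * d) :: rat) = of_int (b * c)"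
    by (auto simp: frac_of_def field_simps)
  then show ?thesis by (simp only: of_int_eq_iff)
qed

text \<open>With Bezout coefficients \<open>x * a + y * b = 1\<close>, the candidate factor is
  \<open>s = x * c + y * d\<close>. It divides both \<open>c\<close> and \<open>d\<close>, so
  coprimality makes it a unit.\<close>

lemma coprime_cross_eq:
  fixes a b c d :: int
  assumes "coprime a b" "coprime c d" "a * d = b * c"
  obtains s where "s = 1 \<or> s = - 1" "c = s * a" "d = s * b"
proof -
  obtain x y where xy: "x * a + y * b = 1"
    using bezout_int[of a b] assms(1) by auto
  define s where "s = x * c + y * d"
  have "s * a = c * (x * a + y * b)" "s * b = d * (x * a + y * b)"
    using assms(3) by (auto simp: s_def algebra_simps)
  then have c: "c = s * a" and d: "d = s * b" using xy by auto
  then have "s dvd 1" using assms(2) by (meson coprime_common_divisor dvd_triv_left)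
  then have "s = 1 \<or> s = - 1" by auto
  then show ?thesis using c d that by blast
qed

lemma coprime_imp_nonzero: "coprime (a::int) b \<Longrightarrow> a \<noteq> 0 \<or> b \<noteq> 0"
  by auto

text \<open>Passing to another reduced representative of a vertex multiplies the determinant by 1 or
  -1, so the existential definition can be tested on any given representatives.\<close>

lemma farey_adjacent_iff:
  assumes "coprime a b" "coprime c d"
  shows "farey_adjacent (frac_of a b) (frac_of c d) \<longleftrightarrow> a * d - b * c = 1 \<or> a * d - b * c = -1"
proof
  assume "farey_adjacent (frac_of a b) (frac_of c d)"
  then obtain a' b' c' d' where *: "coprime a' b'" "coprime c' d'"
      "frac_of a b = frac_of a' b'" "frac_of c d = frac_of c' d'"
    and det: "a' * d' - b' * c' = 1 \<or> a' * d' - b' * c' = -1"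
    unfolding farey_adjacent_def by blast
  have ab: "a * b' = b * a'" and cd: "c * d' = d * c'"
    using * assms frac_of_eq_iff coprime_imp_nonzero by blast+
  obtain s where s: "s = 1 \<or> s = - 1" "a' = s * a" "b' = s * b"
    by (rule coprime_cross_eq[OF assms(1) *(1) ab])
  obtain t where t: "t = 1 \<or> t = - 1" "c' = t * c" "d' = t * d"
    by (rule coprime_cross_eq[OF assms(2) *(2) cd])
  show "a * d - b * c = 1 \<or> a * d - b * c = -1"
    using det s t by auto
qed (use assms in \<open>auto simp: farey_adjacent_def\<close>)

text \<open>Multiplying numerator and denominator by \<open>b\<close> turns the case distinction of
  \<open>mobius\<close> into the linear action of \<open>A\<close> on the column with entries
  \<open>a\<close> and \<open>b\<close>.\<close>

lemma mobius_frac_of: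
  assumes "a \<noteq> 0 \<or> b \<noteq> 0"
  shows "mobius A (frac_of a b)
    = frac_of (A $ 1 $ 1 * a + A $ 1 $ 2 * b) (A $ 2 $ 1 * a + A $ 2 $ 2 * b)"
proof (cases "b = 0")
  case True
  then show ?thesis using assms by (auto simp: frac_of_def)
next
  case False
  have lin: "of_int x * (of_int a / of_int b) + of_int y = (of_int (x * a + y * b) / of_int b :: rat)" for x y
    using False by (simp add: field_simps)
  show ?thesis using False
    by (simp only: frac_of_def mobius.simps Let_def lin if_False of_int_eq_0_iff divide_eq_0_iff) auto
qed

section \<open>Normalised representatives\<close>

lemma int_bidirectional_induct:
  fixes i :: int
  assumes "P 0" "\<And>i. P i \<Longrightarrow> P (i + 1)" "\<And>i. P (i + 1) \<Longrightarrow> P i"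
  shows "P i"
proof (induction i rule: int_induct[where k = 0])
  case (step2 i)
  then show ?case using assms(3)[of "i - 1"] by simp
qed (use assms in auto)

lemma coprime_if_det_1:
  fixes a b c d :: int
  assumes "a * d - c * b = 1"
  shows "coprime a b"
proof (rule coprimeI)
  fix k assume "k dvd a" "k dvd b"
  then have "k dvd a * d - c * b" by simp
  then show "is_unit k" using assms by simp
qed

lemma normalised_iff:
  "normalised v a b \<longleftrightarrow>
    (\<forall>i. v i = frac_of (a i) (b i) \<and> a i * b (i + 1) - a (i + 1) * b i = 1)"
  unfolding normalised_def using coprime_if_det_1 by blast

lemma normalised_nonzero: "normalised v a b \<Longrightarrow> a i \<noteq> 0 \<or> b i \<noteq> 0"
  unfolding normalised_def using coprime_imp_nonzero by blast

lemma normalised_adjacent: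
  assumes "normalised v a b"
  shows "farey_adjacent (v i) (v (i + 1))"
proof -
  have "coprime (a i) (b i)" "coprime (a (i + 1)) (b (i + 1))" "v i = frac_of (a i) (b i)"
    "v (i + 1) = frac_of (a (i + 1)) (b (i + 1))" "a i * b (i + 1) - a (i + 1) * b i = 1"
    using assms unfolding normalised_def by blast+
  then show ?thesis by (simp add: farey_adjacent_iff mult.commute)
qed

text \<open>Reduced representatives differ by signs \<open>s i\<close>. The determinant condition on
  neighbours forces \<open>s i * s (i + 1) = 1\<close>, so the sign is constant, and it enters each
  entry of the tiling squared.\<close>

lemma tiling_of_unique:
  assumes "normalised v a b" "normalised v a' b'"
  shows "tiling_of a b = tiling_of a' b'"
proof -
  have "\<exists>s. (s = 1 \<or> s = - 1) \<and> a' i = s * a i \<and> b' i = s * b i" for i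
  proof -
    have "a i * b' i = b i * a' i"
      using frac_of_eq_iff[OF normalised_nonzero[OF assms(1)] normalised_nonzero[OF assms(2)]] assms
      unfolding normalised_def by metis
    then show ?thesis
      using coprime_cross_eq[of "a i" "b i" "a' i" "b' i"] assms unfolding normalised_def by metis
  qed
  then obtain s where s: "\<And>i. s i = 1 \<or> s i = - (1::int)"
    and a': "\<And>i. a' i = s i * a i" and b': "\<And>i. b' i = s i * b i"
    by metis
  have step: "s (i + 1) = s i" for i
  proof -
    have "s i * s (i + 1) * (a i * b (i + 1) - a (i + 1) * b i)
        = a' i * b' (i + 1) - a' (i + 1) * b' i"
      unfolding a' b' by (simp add: algebra_simps)
    also have "\<dots> = 1" using assms(2) unfolding normalised_def by blast
    finally have "s i * s (i + 1) * (a i * b (i + 1) - a (i + 1) * b i) = 1" .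
    then have "s i * s (i + 1) = 1" using assms(1) unfolding normalised_def by simp
    then show ?thesis using s[of i] by auto
  qed
  have const: "s i = s 0" for i
    by (induction i rule: int_bidirectional_induct) (use step in auto)
  have "tiling_of a' b' i j = s 0 * s 0 * tiling_of a b i j" for i j
    unfolding tiling_of_def a' b' const[of i] const[of j] by (simp add: algebra_simps)
  then show ?thesis using s[of 0] by (intro ext) auto
qed

lemma normalised_exists:
  assumes "\<And>i. farey_adjacent (v i) (v (i + 1))"
  shows "\<exists>a b. normalised v a b"
proof -
  have "\<exists>p q. coprime p q \<and> v i = frac_of p q" for i
    using assms[of i] unfolding farey_adjacent_def by blast
  then obtain p q where pq: "\<And>i. coprime (p i) (q i)" "\<And>i. v i = frac_of (p i) (q i)"
    by metis
  define e where "e i = p i * q (i + 1) - q i * p (i + 1)" for i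
  have e: "e i = 1 \<or> e i = - 1" for i
    using assms[of i] pq by (simp add: farey_adjacent_iff e_def)
  \<comment> \<open>Rescaling \<open>p\<^sub>i/q\<^sub>i\<close> by \<open>s\<^sub>i\<close> multiplies \<open>e\<^sub>i\<close> by \<open>s\<^sub>i s\<^sub>i\<^sub>+\<^sub>1\<close>; one of the two products below is
    always empty.\<close>
  define s where "s i = (\<Prod>k\<in>{0..<i}. e k) * (\<Prod>k\<in>{i..<0}. e k)" for i
  have s: "s i = 1 \<or> s i = - 1" for i
  proof -
    \<comment> \<open>Stated for arbitrary \<open>K\<close>: a product over an infinite set is 1 by
      convention.\<close>
    have *: "(\<Prod>k\<in>K. e k) = 1 \<or> (\<Prod>k\<in>K. e k) = - 1" for K
      using e by (induction K rule: infinite_finite_induct) force+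
    show ?thesis using *[of "{0..<i}"] *[of "{i..<0}"] unfolding s_def by auto
  qed
  have "s i * s (i + 1) = e i" for i
  proof (cases "i \<ge> 0")
    case True
    then have "{0..<i + 1} = insert i {0..<i}" by auto
    then have "s (i + 1) = e i * s i" using True by (simp add: s_def)
    then show ?thesis using s[of i] by auto
  next
    case False
    then have "{i..<0} = insert i {i + 1..<0}" by auto
    then have "s i = e i * s (i + 1)" using False by (simp add: s_def)
    then show ?thesis using s[of "i + 1"] by auto
  qed
  then have "s i * s (i + 1) * e i = 1" for i using e[of i] by auto
  moreover have "s i * p i * (s (i + 1) * q (i + 1)) - s (i + 1) * p (i + 1) * (s i * q i)
      = s i * s (i + 1) * e i" for i
    unfolding e_def by (simp add: algebra_simps)
  ultimately have "s i * p i * (s (i + 1) * q (i + 1)) - s (i + 1) * p (i + 1) * (s i * q i) = 1" for i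
    by simp
  moreover have "v i = frac_of (s i * p i) (s i * q i)" for i
    using s[of i] coprime_imp_nonzero[OF pq(1)[of i]]
    by (auto simp: pq(2) frac_of_eq_iff)
  ultimately have "normalised v (\<lambda>i. s i * p i) (\<lambda>i. s i * q i)"
    unfolding normalised_iff by blast
  then show ?thesis by blast
qed

lemma tiling_of_neighbour: "normalised v a b \<Longrightarrow> tiling_of a b i (i + 1) = - 1"
  unfolding normalised_def tiling_of_def by (smt (verit) mult.commute)

section \<open>Tilings and orbits\<close>

text \<open>\<open>A\<close> acts linearly on the representatives and multiplies every determinant
  of two of them by \<open>det A = 1\<close>.\<close>

lemma normalised_mobius:
  assumes "normalised v a b" "det A = 1"
  defines "a' \<equiv> \<lambda>i. A $ 1 $ 1 * a i + A $ 1 $ 2 * b i"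
    and "b' \<equiv> \<lambda>i. A $ 2 $ 1 * a i + A $ 2 $ 2 * b i"
  shows "normalised (\<lambda>i. mobius A (v i)) a' b'" "tiling_of a' b' = tiling_of a b"
proof -
  have *: "a' i * b' j - a' j * b' i = a i * b j - a j * b i" for i j
  proof -
    have "a' i * b' j - a' j * b' i = det A * (a i * b j - a j * b i)"
      unfolding a'_def b'_def det_2 by (simp add: algebra_simps)
    then show ?thesis using assms(2) by simp
  qed
  have "mobius A (v i) = frac_of (a' i) (b' i)" for i
  proof -
    have "v i = frac_of (a i) (b i)" using assms(1) unfolding normalised_def by blast
    then show ?thesis
      using mobius_frac_of[OF normalised_nonzero[OF assms(1)], of A i] by (simp add: a'_def b'_def)
  qed
  then show "normalised (\<lambda>i. mobius A (v i)) a' b'"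
    using * assms(1) by (simp add: normalised_iff)
  show "tiling_of a' b' = tiling_of a b"
    unfolding tiling_of_def
  proof (intro ext)
    show "a' j * b' i - b' j * a' i = a j * b i - b j * a i" for i j
      using *[of j i] by (simp add: mult.commute)
  qed
qed

lemma mobius_if_tiling_of_eq:
  assumes "normalised v a b" "normalised w c d" "tiling_of a b = tiling_of c d"
  obtains A where "det A = 1" "\<And>i. w i = mobius A (v i)"
proof -
  \<comment> \<open>The matrix with columns \<open>(c 0, d 0)\<close> and \<open>(c 1, d 1)\<close>
    times the inverse of the one with columns \<open>(a 0, b 0)\<close> and
    \<open>(a 1, b 1)\<close>: it carries the first two representatives of \<open>v\<close> to those
    of \<open>w\<close>.\<close>
  define A :: "int^2^2" where "A = vector
    [vector [c 0 * b 1 - c 1 * b 0, a 0 * c 1 - a 1 * c 0],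
     vector [d 0 * b 1 - d 1 * b 0, a 0 * d 1 - a 1 * d 0]]"
  have one: "a 0 * b 1 - a 1 * b 0 = 1" "c 0 * d 1 - c 1 * d 0 = 1"
    using assms(1,2)[unfolded normalised_def, rule_format, of 0] by simp_all
  have "det A = (a 0 * b 1 - a 1 * b 0) * (c 0 * d 1 - c 1 * d 0)"
    unfolding A_def det_2 by (simp add: algebra_simps)
  then have det: "det A = 1" using one by simp
  have eq: "w i = mobius A (v i)" for i
  proof -
    have m: "a i * b k - b i * a k = c i * d k - d i * c k" for k
      using fun_cong[OF fun_cong[OF assms(3), of k], of i] by (simp add: tiling_of_def)
    \<comment> \<open>Grouped so that \<open>a\<close> and \<open>b\<close> occur only in
      determinants, which \<open>m\<close> replaces by those of \<open>c\<close> and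
      \<open>d\<close>. What remains is the Pluecker relation for three vectors in the
      plane.\<close>
    have "A $ 1 $ 1 * a i + A $ 1 $ 2 * b i
        = c 0 * (a i * b 1 - b i * a 1) - c 1 * (a i * b 0 - b i * a 0)"
      unfolding A_def by (simp add: algebra_simps)
    also have "\<dots> = c i * (c 0 * d 1 - c 1 * d 0)"
      unfolding m by (simp add: algebra_simps)
    finally have c: "A $ 1 $ 1 * a i + A $ 1 $ 2 * b i = c i" using one by simp
    have "A $ 2 $ 1 * a i + A $ 2 $ 2 * b i
        = d 0 * (a i * b 1 - b i * a 1) - d 1 * (a i * b 0 - b i * a 0)"
      unfolding A_def by (simp add: algebra_simps)
    also have "\<dots> = d i * (c 0 * d 1 - c 1 * d 0)"
      unfolding m by (simp add: algebra_simps)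
    finally have d: "A $ 2 $ 1 * a i + A $ 2 $ 2 * b i = d i" using one by simp
    have "v i = frac_of (a i) (b i)" "w i = frac_of (c i) (d i)"
      using assms(1,2) unfolding normalised_def by blast+
    then show ?thesis
      using mobius_frac_of[OF normalised_nonzero[OF assms(1)], of A i] c d by simp
  qed
  show ?thesis using that det eq by blast
qed

section \<open>Closed paths and their periodic extensions\<close>

lemma periodic_extension_of_nat:
  assumes "n > 0" "vs ! 0 = vs ! n" "k \<le> n"
  shows "periodic_extension n vs (int k) = vs ! k"
  using assms by (cases "k = n") (auto simp: periodic_extension_def)

lemma periodic_extension_map:
  assumes "n > 0" "length vs = n + 1"
  shows "periodic_extension n (map f vs) i = f (periodic_extension n vs i)"
proof -
  have "nat (i mod int n) < length vs"
    using assms by (simp add: nat_less_iff less_SucI)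
  then show ?thesis by (simp add: periodic_extension_def)
qed

lemma closed_paths_iff:
  assumes "n > 0"
  shows "vs \<in> closed_paths n \<longleftrightarrow> length vs = n + 1 \<and> vs ! 0 = vs ! n \<and>
    (\<forall>i. farey_adjacent (periodic_extension n vs i) (periodic_extension n vs (i + 1)))"
proof (intro iffI conjI allI)
  fix i assume vs: "vs \<in> closed_paths n"
  define k where "k = nat (i mod int n)"
  have k: "k < n" "int k = i mod int n" using assms by (simp_all add: k_def nat_less_iff)
  have "periodic_extension n vs (i + 1) = periodic_extension n vs (int k + 1)"
    unfolding periodic_extension_def k by (simp add: mod_simps)
  \<comment> \<open>Here \<open>k + 1\<close> may equal \<open>n\<close>, where the extension reads
    \<open>vs ! 0\<close>; closedness identifies it with \<open>vs ! n\<close>.\<close>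
  also have "\<dots> = vs ! (k + 1)"
    using periodic_extension_of_nat[OF assms, of vs "k + 1"] vs k
    by (simp add: closed_paths_def add.commute)
  finally show "farey_adjacent (periodic_extension n vs i) (periodic_extension n vs (i + 1))"
    using vs k by (simp add: closed_paths_def periodic_extension_def k_def)
next
  assume *: "length vs = n + 1 \<and> vs ! 0 = vs ! n \<and>
    (\<forall>i. farey_adjacent (periodic_extension n vs i) (periodic_extension n vs (i + 1)))"
  have "farey_adjacent (vs ! k) (vs ! (k + 1))" if "k < n" for k
    using *[THEN conjunct2, THEN conjunct2, rule_format, of "int k"] that
      periodic_extension_of_nat[OF assms, of vs k] periodic_extension_of_nat[OF assms, of vs "k + 1"] *
    by (simp add: add.commute)
  then show "vs \<in> closed_paths n" using * by (simp add: closed_paths_def)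
qed (auto simp: closed_paths_def)

section \<open>Orbits as fibres of the tiling\<close>

text \<open>A relation, so that no normalisation has to be chosen. It fixes the tiling itself, not
  only its class up to sign.\<close>

definition path_tiling :: "nat \<Rightarrow> qinf list \<Rightarrow> (int \<Rightarrow> int \<Rightarrow> int) \<Rightarrow> bool" where
  "path_tiling n vs m \<longleftrightarrow> (\<exists>a b. normalised (periodic_extension n vs) a b \<and> m = tiling_of a b)"

lemma path_tiling_unique: "path_tiling n vs m \<Longrightarrow> path_tiling n vs m' \<Longrightarrow> m = m'"
  unfolding path_tiling_def using tiling_of_unique by blast

lemma path_tiling_exists: "n > 0 \<Longrightarrow> vs \<in> closed_paths n \<Longrightarrow> \<exists>m. path_tiling n vs m"
  unfolding path_tiling_def using closed_paths_iff normalised_exists by metis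

text \<open>The tiling is a complete invariant of the orbit: \<open>normalised_mobius\<close> gives
  invariance, and \<open>mobius_if_tiling_of_eq\<close> recovers the group element from equal
  tilings.\<close>

lemma orbit_eq:
  assumes "n > 0" "vs \<in> closed_paths n" "path_tiling n vs m"
  shows "orbit SL2Z (\<lambda>A. map (mobius A)) vs = {ws \<in> closed_paths n. path_tiling n ws m}"
proof -
  obtain a b where ab: "normalised (periodic_extension n vs) a b" "m = tiling_of a b"
    using assms(3) unfolding path_tiling_def by blast
  have len: "length vs = n + 1" "vs ! 0 = vs ! n"
    using assms(2) by (simp_all add: closed_paths_def)
  show ?thesis
  proof (intro equalityI subsetI)
    fix ws assume "ws \<in> orbit SL2Z (\<lambda>A. map (mobius A)) vs"
    then obtain A where A: "det A = 1" "ws = map (mobius A) vs"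
      by (auto simp: orbit_def SL2Z_def)
    have pe: "periodic_extension n ws = (\<lambda>i. mobius A (periodic_extension n vs i))"
      using periodic_extension_map[OF assms(1) len(1)] A by blast
    obtain c d where cd: "normalised (periodic_extension n ws) c d" "m = tiling_of c d"
      unfolding pe ab(2) using that normalised_mobius[OF ab(1) A(1)] by simp
    then have "ws \<in> closed_paths n"
      using normalised_adjacent[OF cd(1)] len A(2) by (simp add: closed_paths_iff[OF assms(1)])
    then show "ws \<in> {ws \<in> closed_paths n. path_tiling n ws m}"
      using cd unfolding path_tiling_def by blast
  next
    fix ws assume "ws \<in> {ws \<in> closed_paths n. path_tiling n ws m}"
    then obtain c d where ws: "ws \<in> closed_paths n"
      and cd: "normalised (periodic_extension n ws) c d" "m = tiling_of c d"
      unfolding path_tiling_def by blast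
    have len': "length ws = n + 1" "ws ! 0 = ws ! n"
      using ws by (simp_all add: closed_paths_def)
    obtain A where A: "det A = 1"
        "\<And>i. periodic_extension n ws i = mobius A (periodic_extension n vs i)"
      using mobius_if_tiling_of_eq[OF ab(1) cd(1)] ab(2) cd(2) by metis
    have "ws ! k = mobius A (vs ! k)" if "k \<le> n" for k
      using A(2)[of "int k"] len len' that by (simp add: periodic_extension_of_nat assms(1))
    then have "ws = map (mobius A) vs"
      using len len' by (intro nth_equalityI) auto
    then show "ws \<in> orbit SL2Z (\<lambda>A. map (mobius A)) vs"
      using A(1) by (auto simp: orbit_def SL2Z_def)
  qed
qed

text \<open>Evaluates the definite description. It has at most one solution because
  \<open>vs\<close> lies in its own orbit and has a normalisation, so the condition is not
  vacuous.\<close>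

lemma Phi_eq:
  assumes "n > 0" "vs \<in> closed_paths n" "path_tiling n vs m"
  shows "Phi n (orbit SL2Z (\<lambda>A. map (mobius A)) vs) = plus_minus m"
  unfolding Phi_def
proof (rule the_equality)
  show "\<forall>ws\<in>orbit SL2Z (\<lambda>A. map (mobius A)) vs. \<forall>a b.
    normalised (periodic_extension n ws) a b \<longrightarrow> plus_minus m = plus_minus (tiling_of a b)"
  proof (intro ballI allI impI)
    fix ws a b
    assume "ws \<in> orbit SL2Z (\<lambda>A. map (mobius A)) vs" and ab: "normalised (periodic_extension n ws) a b"
    then have "path_tiling n ws m" using orbit_eq[OF assms] by blast
    moreover have "path_tiling n ws (tiling_of a b)" using ab unfolding path_tiling_def by blast
    ultimately show "plus_minus m = plus_minus (tiling_of a b)" using path_tiling_unique by metis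
  qed
next
  fix P
  assume P: "\<forall>ws\<in>orbit SL2Z (\<lambda>A. map (mobius A)) vs. \<forall>a b.
    normalised (periodic_extension n ws) a b \<longrightarrow> P = plus_minus (tiling_of a b)"
  have "vs \<in> orbit SL2Z (\<lambda>A. map (mobius A)) vs" using orbit_eq[OF assms] assms by blast
  then show "P = plus_minus m" using P assms(3) unfolding path_tiling_def by blast
qed

section \<open>Tilings of closed paths are the tame friezes\<close>

text \<open>The tiling is a product of a two-column and a two-row matrix, so its 2 by 2 minors
  factor into determinants of neighbouring representatives.\<close>

lemma tiling_of_SL2_tiling:
  assumes "normalised v a b"
  shows "SL2_tiling (tiling_of a b)"
  unfolding SL2_tiling_def
proof (intro allI)
  fix i j
  have "tiling_of a b i j * tiling_of a b (i + 1) (j + 1)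
      - tiling_of a b i (j + 1) * tiling_of a b (i + 1) j
    = (a i * b (i + 1) - a (i + 1) * b i) * (a j * b (j + 1) - a (j + 1) * b j)"
    unfolding tiling_of_def by (simp add: algebra_simps)
  then show "tiling_of a b i j * tiling_of a b (i + 1) (j + 1)
      - tiling_of a b i (j + 1) * tiling_of a b (i + 1) j = 1"
    using assms unfolding normalised_def by simp
qed

text \<open>Every row is a combination of the sequences \<open>a\<close> and \<open>b\<close>, so
  the rank is at most two and all 3 by 3 minors vanish.\<close>

lemma tiling_of_tame: "tame (tiling_of a b)"
  unfolding tame_def tiling_of_def det_3 by (simp add: algebra_simps)

lemma path_tiling_tame_frieze:
  assumes "n > 0" "path_tiling n vs m"
  shows "tame_frieze n m"
proof -
  obtain a b where ab: "normalised (periodic_extension n vs) a b" "m = tiling_of a b"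
    using assms(2) unfolding path_tiling_def by blast
  have "m (i + int n) i = 0" for i
  proof -
    have "frac_of (a (i + int n)) (b (i + int n)) = periodic_extension n vs (i + int n)"
      using ab(1) unfolding normalised_def by metis
    also have "\<dots> = frac_of (a i) (b i)"
      using ab(1) unfolding normalised_def periodic_extension_def by (metis mod_add_self2)
    finally show ?thesis
      using frac_of_eq_iff[OF normalised_nonzero[OF ab(1)] normalised_nonzero[OF ab(1)]]
      by (simp add: ab(2) tiling_of_def mult.commute)
  qed
  moreover have "m i i = 0" for i by (simp add: ab(2) tiling_of_def)
  ultimately show ?thesis
    using tiling_of_SL2_tiling[OF ab(1)] tiling_of_tame ab(2) by (simp add: tame_frieze_def)
qed

section \<open>Linear dependence between the rows of a tame tiling\<close>

lemma SL2_tiling_row_recurrence: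
  assumes "SL2_tiling m" "tame m"
  shows "\<exists>c. \<forall>j. m (i + 2) j = c * m (i + 1) j - m i j"
proof -
  let ?x = "m i" and ?y = "m (i + 1)" and ?z = "m (i + 2)"
  have xy: "?x j * ?y (j + 1) - ?x (j + 1) * ?y j = 1" for j
    using assms(1) unfolding SL2_tiling_def by blast
  have yz: "?y j * ?z (j + 1) - ?y (j + 1) * ?z j = 1" for j
    using assms(1)[unfolded SL2_tiling_def, rule_format, of "i + 1" j] by (simp add: add.assoc)
  \<comment> \<open>By Cramer's rule, the coefficient that works for columns \<open>j\<close> and \<open>j + 1\<close>.\<close>
  define c where "c j = ?x j * ?z (j + 1) - ?x (j + 1) * ?z j" for j
  have z0: "?z j = c j * ?y j - ?x j" for j
  proof -
    have "c j * ?y j - ?x j * (?y j * ?z (j + 1) - ?y (j + 1) * ?z j)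
        = ?z j * (?x j * ?y (j + 1) - ?x (j + 1) * ?y j)"
      by (simp add: c_def algebra_simps)
    then show ?thesis by (simp add: xy yz)
  qed
  have z1: "?z (j + 1) = c j * ?y (j + 1) - ?x (j + 1)" for j
  proof -
    have "c j * ?y (j + 1) - ?x (j + 1) * (?y j * ?z (j + 1) - ?y (j + 1) * ?z j)
        = ?z (j + 1) * (?x j * ?y (j + 1) - ?x (j + 1) * ?y j)"
      by (simp add: c_def algebra_simps)
    then show ?thesis by (simp add: xy yz)
  qed
  have z2: "?z (j + 2) = c j * ?y (j + 2) - ?x (j + 2)" for j
  proof -
    \<comment> \<open>Cofactor expansion of the vanishing 3 by 3 determinant along its third column,
      with minors 1, \<open>c j\<close> and 1.\<close>
    have "?x (j + 2) * (?y j * ?z (j + 1) - ?y (j + 1) * ?z j) - ?y (j + 2) * c j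
        + ?z (j + 2) * (?x j * ?y (j + 1) - ?x (j + 1) * ?y j) = 0"
      using assms(2)[unfolded tame_def, rule_format, of i j]
      unfolding det_3 by (simp add: c_def algebra_simps)
    then show ?thesis unfolding xy yz by (simp add: mult.commute)
  qed
  have step: "c (j + 1) = c j" for j
  proof -
    have 1: "c (j + 1) * ?y (j + 1) = c j * ?y (j + 1)"
      using z0[of "j + 1"] z1[of j] by linarith
    have 2: "c (j + 1) * ?y (j + 2) = c j * ?y (j + 2)"
      using z1[of "j + 1"] z2[of j] unfolding add.assoc one_add_one by linarith
    \<comment> \<open>Both \<open>c j\<close> and \<open>c (j + 1)\<close> serve columns
      \<open>j + 1\<close> and \<open>j + 2\<close>; the entries of \<open>?y\<close> there cannot
      both vanish, since a minor containing them is 1.\<close>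
    have "?y (j + 1) \<noteq> 0 \<or> ?y (j + 2) \<noteq> 0"
      using xy[of "j + 1"] by (auto simp: add.assoc)
    then show ?thesis using 1 2 by auto
  qed
  have const: "c j = c 0" for j
    by (induction j rule: int_bidirectional_induct) (use step in auto)
  show ?thesis using z0 const by metis
qed

text \<open>In the row recurrence both outer rows have coefficient 1 or -1, so it can be solved over
  the integers for the next row and for the previous one.\<close>

lemma tame_SL2_tiling_rows:
  assumes "SL2_tiling m" "tame m"
  shows "\<exists>x y. \<forall>j. m i j = x * m 0 j + y * m 1 j"
proof -
  define P where "P i \<longleftrightarrow> (\<exists>x y. \<forall>j. m i j = x * m 0 j + y * m 1 j)" for i
  have lin: "P k" if P: "P i" "P i'" and k: "\<And>j. m k j = c * m i j - m i' j" for i i' k c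
  proof -
    obtain x y x' y' where "\<And>j. m i j = x * m 0 j + y * m 1 j" "\<And>j. m i' j = x' * m 0 j + y' * m 1 j"
      using P unfolding P_def by metis
    then have "m k j = (c * x - x') * m 0 j + (c * y - y') * m 1 j" for j
      by (simp add: k algebra_simps)
    then show ?thesis unfolding P_def by blast
  qed
  have "m 0 j = 1 * m 0 j + 0 * m 1 j" "m 1 j = 0 * m 0 j + 1 * m 1 j" for j by simp_all
  then have base: "P 0" "P 1" unfolding P_def by blast+
  have "P i \<and> P (i + 1)"
  proof (induction i rule: int_bidirectional_induct)
    case (2 i)
    obtain c where "\<And>j. m (i + 2) j = c * m (i + 1) j - m i j"
      using SL2_tiling_row_recurrence[OF assms] by metis
    then have "P (i + 2)" using lin[of "i + 1" i "i + 2" c] 2 by blast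
    then show ?case using 2 by (simp add: add.assoc)
  next
    case (3 i)
    then have 3: "P (i + 1)" "P (i + 2)" by (simp_all add: add.assoc)
    obtain c where "\<And>j. m (i + 2) j = c * m (i + 1) j - m i j"
      using SL2_tiling_row_recurrence[OF assms] by metis
    then have "m i j = c * m (i + 1) j - m (i + 2) j" for j by simp
    then show ?case using lin[of "i + 1" "i + 2" i c] 3 by blast
  qed (use base in simp)
  then show ?thesis unfolding P_def by blast
qed

lemma tame_SL2_tiling_eq_tiling_of:
  assumes "SL2_tiling m" "tame m" "\<And>i. m i i = 0" "\<And>i. m i (i + 1) = - 1"
  shows "m = tiling_of (m 0) (m 1)"
proof (intro ext)
  fix i j
  have det: "m 0 k * m 1 (k + 1) - m 0 (k + 1) * m 1 k = 1" for k
    using assms(1)[unfolded SL2_tiling_def, rule_format, of 0 k] by simp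
  obtain x y where xy: "\<And>j. m i j = x * m 0 j + y * m 1 j"
    using tame_SL2_tiling_rows[OF assms(1,2)] by metis
  \<comment> \<open>The coefficients \<open>x, y\<close> are found from columns \<open>i\<close> and \<open>i + 1\<close>.\<close>
  have "x * m 0 i + y * m 1 i = 0" "x * m 0 (i + 1) + y * m 1 (i + 1) = - 1"
    using xy[of i] xy[of "i + 1"] assms(3,4) by simp_all
  then have *: "x * m 0 i = - y * m 1 i" "y * m 1 (i + 1) = - 1 - x * m 0 (i + 1)"
    "y * m 1 i = - x * m 0 i" "x * m 0 (i + 1) = - 1 - y * m 1 (i + 1)"
    by simp_all
  \<comment> \<open>Cramer's rule without division: the determinant is 1, and the terms in
    \<open>y\<close> cancel.\<close>
  have "x * (m 0 i * m 1 (i + 1) - m 0 (i + 1) * m 1 i)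
      = (x * m 0 i) * m 1 (i + 1) - (x * m 0 (i + 1)) * m 1 i"
    by (simp add: algebra_simps)
  also have "\<dots> = m 1 i"
    unfolding *(1,4) by (simp add: algebra_simps)
  finally have x: "x = m 1 i" using det by simp
  have "y * (m 0 i * m 1 (i + 1) - m 0 (i + 1) * m 1 i)
      = m 0 i * (y * m 1 (i + 1)) - m 0 (i + 1) * (y * m 1 i)"
    by (simp add: algebra_simps)
  also have "\<dots> = - m 0 i"
    unfolding *(2,3) by (simp add: algebra_simps)
  finally have y: "y = - m 0 i" using det by simp
  show "m i j = tiling_of (m 0) (m 1) i j"
    unfolding tiling_of_def xy[of j] x y by (simp add: algebra_simps)
qed

text \<open>Rows 0 and 1 serve as numerators and denominators of the path. The zeros at
  \<open>(i + n, i)\<close> make representatives \<open>n\<close> apart proportional, which is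
  periodicity of the vertices.\<close>

lemma tame_frieze_path_tiling:
  assumes "n > 0" "tame_frieze n m" "m 0 1 = - 1"
  obtains vs where "vs \<in> closed_paths n" "path_tiling n vs m"
proof -
  have m: "SL2_tiling m" "tame m" "\<And>i. m i i = 0" "\<And>i. m (i + int n) i = 0"
    using assms(2) unfolding tame_frieze_def by blast+
  \<comment> \<open>The minor at \<open>(i, i + 1)\<close> contains the diagonal zero
    \<open>m (i + 1) (i + 1)\<close>, so the sign at \<open>(0, 1)\<close> propagates along the
    whole superdiagonal.\<close>
  have step: "m i (i + 1) * m (i + 1) (i + 2) = 1" for i
    using m(1)[unfolded SL2_tiling_def, rule_format, of i "i + 1"] m(3)[of "i + 1"]
    by (simp add: add.assoc)
  have diag: "m i (i + 1) = - 1" for i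
  proof (induction i rule: int_bidirectional_induct)
    case (2 i)
    then show ?case using step[of i] by (simp add: add.assoc)
  next
    case (3 i)
    then show ?case using step[of i] by (simp add: add.assoc)
  qed (use assms in simp)
  have eq: "m = tiling_of (m 0) (m 1)"
    using tame_SL2_tiling_eq_tiling_of m diag by blast
  define v where "v i = frac_of (m 0 i) (m 1 i)" for i
  have v: "normalised v (m 0) (m 1)"
    using m(1)[unfolded SL2_tiling_def, rule_format, of 0] by (simp add: normalised_iff v_def)
  have per: "v (i + int n) = v i" for i
  proof -
    have "tiling_of (m 0) (m 1) (i + int n) i = 0" using m(4) eq by metis
    then show ?thesis
      using frac_of_eq_iff[OF normalised_nonzero[OF v] normalised_nonzero[OF v]]
      by (simp add: tiling_of_def v_def mult.commute)
  qed
  have per': "v (i + int n * k) = v i" for i k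
  proof (induction k rule: int_bidirectional_induct)
    case (2 k)
    then show ?case using per[of "i + int n * k"] by (simp add: algebra_simps)
  next
    case (3 k)
    then show ?case using per[of "i + int n * k"] by (simp add: algebra_simps)
  qed simp
  define vs where "vs = map (\<lambda>k. v (int k)) [0..<n + 1]"
  have nth: "vs ! k = v (int k)" if "k \<le> n" for k
    using that by (simp add: vs_def del: upt_Suc)
  have "periodic_extension n vs i = v i" for i
  proof -
    have "nat (i mod int n) \<le> n" using assms(1) by (simp add: nat_le_iff less_imp_le)
    then have "periodic_extension n vs i = v (i mod int n)"
      using assms(1) by (simp add: periodic_extension_def nth)
    also have "\<dots> = v i"
      using per'[of "i mod int n" "i div int n"] by simp
    finally show ?thesis .
  qed
  then have pe: "periodic_extension n vs = v" by blast
  have "vs ! 0 = vs ! n" using nth per[of 0] by simp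
  moreover have "length vs = n + 1" by (simp add: vs_def)
  ultimately have "vs \<in> closed_paths n"
    using normalised_adjacent[OF v] by (simp add: closed_paths_iff[OF assms(1)] pe)
  moreover have "path_tiling n vs m"
    unfolding path_tiling_def pe using v eq by blast
  ultimately show ?thesis using that by blast
qed

section \<open>Sign changes and the bijection\<close>

lemma tame_frieze_uminus:
  assumes "tame_frieze n m"
  shows "tame_frieze n (\<lambda>i j. - m i j)"
proof -
  have "tame (\<lambda>i j. - m i j)"
    unfolding tame_def
  proof (intro allI)
    fix i j
    show "det (vector
        [vector [- m i j, - m i (j + 1), - m i (j + 2)],
         vector [- m (i + 1) j, - m (i + 1) (j + 1), - m (i + 1) (j + 2)],
         vector [- m (i + 2) j, - m (i + 2) (j + 1), - m (i + 2) (j + 2)]] :: int^3^3) = 0"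
      using assms[unfolded tame_frieze_def tame_def, THEN conjunct2, THEN conjunct1, rule_format, of i j]
      unfolding det_3 by simp
  qed
  then show ?thesis using assms unfolding tame_frieze_def SL2_tiling_def by simp
qed

lemma plus_minus_uminus: "plus_minus (\<lambda>i j. - m i j) = plus_minus m"
  unfolding plus_minus_def by auto

theorem theorem1p6:
  fixes n :: nat
  assumes "n > 1"
  shows "bij_betw (Phi n) (path_orbits n) (FR n)"
proof (rule bij_betw_imageI)
  have n: "n > 0" using assms by simp
  have orbitE: "\<exists>vs m. vs \<in> closed_paths n \<and> path_tiling n vs m \<and>
      X = orbit SL2Z (\<lambda>A. map (mobius A)) vs" if "X \<in> path_orbits n" for X
    using that path_tiling_exists[OF n] unfolding path_orbits_def orbits_def by blast
  \<comment> \<open>This entry singles out the sign: a tiling and its negative cannot both come from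
    paths, so the class determines the tiling and hence the orbit.\<close>
  have neighbour: "m 0 1 = - 1" if "path_tiling n vs m" for vs m
    using that tiling_of_neighbour[where i = 0] unfolding path_tiling_def by force
  show "inj_on (Phi n) (path_orbits n)"
  proof (rule inj_onI)
    fix X Y assume "X \<in> path_orbits n" "Y \<in> path_orbits n" and eq: "Phi n X = Phi n Y"
    then obtain vs ws l m where
      vs: "vs \<in> closed_paths n" "path_tiling n vs l" "X = orbit SL2Z (\<lambda>A. map (mobius A)) vs" and
      ws: "ws \<in> closed_paths n" "path_tiling n ws m" "Y = orbit SL2Z (\<lambda>A. map (mobius A)) ws"
      using orbitE by metis
    have "l \<in> plus_minus m"
      using eq Phi_eq[OF n vs(1,2)] Phi_eq[OF n ws(1,2)] vs(3) ws(3)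
      by (auto simp: plus_minus_def)
    then have "l = m"
      using neighbour[OF vs(2)] neighbour[OF ws(2)] by (auto simp: plus_minus_def)
    then show "X = Y"
      using orbit_eq[OF n vs(1,2)] orbit_eq[OF n ws(1,2)] vs(3) ws(3) by simp
  qed
  show "Phi n ` path_orbits n = FR n"
  proof (intro equalityI subsetI)
    fix P assume "P \<in> Phi n ` path_orbits n"
    then obtain vs m where "path_tiling n vs m" "P = plus_minus m"
      using orbitE Phi_eq[OF n] by blast
    then show "P \<in> FR n" using path_tiling_tame_frieze[OF n] unfolding FR_def by blast
  next
    fix P assume "P \<in> FR n"
    then obtain m where m: "tame_frieze n m" "P = plus_minus m" unfolding FR_def by blast
    \<comment> \<open>The minor at \<open>(0, 0)\<close> with its two diagonal zeros makes
      \<open>m 0 1\<close> a unit, so one of the two members of the class has the sign required of a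
      path tiling.\<close>
    have "m 0 1 * m 1 0 = - 1"
      using m(1)[unfolded tame_frieze_def SL2_tiling_def, THEN conjunct1, rule_format, of 0 0]
        m(1) by (simp add: tame_frieze_def)
    then have "m 0 1 dvd 1" by (metis dvd_minus_iff dvd_triv_left)
    then have "m 0 1 = 1 \<or> m 0 1 = - 1" by auto
    then obtain l where l: "tame_frieze n l" "P = plus_minus l" "l 0 1 = - 1"
      using m tame_frieze_uminus plus_minus_uminus by (metis (no_types, lifting))
    then obtain vs where "vs \<in> closed_paths n" "path_tiling n vs l"
      using tame_frieze_path_tiling[OF n] by blast
    then show "P \<in> Phi n ` path_orbits n"
      using Phi_eq[OF n] l(2) unfolding path_orbits_def orbits_def by blast
  qed
qed

end
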